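(* Let $S$ be a reduced finite subset of $\mathbb{P}^n$, of cardinality $r$, and let $d$ be a positive integer. Assume that $h^1(\mathcal{I}_S(q))=0$ for some integer $q<d/2$. Then $S$ does not belong to the Terracini locus $\mathbb{T}_r(\mathbb{P}^n,\mathcal{O}_{\mathbb{P}^n}(d))$.
   Context: Work over an algebraically closed field of characteristic $0$. $\mathcal{I}_S$ denotes the ideal sheaf of $S$ in $\mathbb{P}^n$. For $p\in\mathbb{P}^n$ the double point $2p$ is the closed subscheme of $\mathbb{P}^n$ supported at $p$ and defined by the square of the maximal ideal of $p$ (of length $n+1$); for a finite reduced set $S\subset\mathbb{P}^n$, $2S=\bigcup_{p\in S}2p$. The $r$-th Terracini locus $\mathbb{T}_r(\mathbb{P}^n,\mathcal{O}_{\mathbb{P}^n}(d))$ is the set of reduced finite sets $S\subset\mathbb{P}^n$ of cardinality $r$ such that $h^0(\mathcal{I}_{2S}(d))>h^0(\mathcal{O}_{\mathbb{P}^n}(d))-(n+1)r$. *)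

theory Defs
  imports
    Complex_Main
    "HOL-Computational_Algebra.Polynomial"
    "HOL-Library.Poly_Mapping"
    "HOL-Library.Extended_Nat"
begin

section \<open>Homogeneous polynomials in \<open>x\<^sub>0, \<dots>, x\<^sub>n\<close>\<close>

type_synonym 'a mpol = "(nat \<Rightarrow>\<^sub>0 nat) \<Rightarrow>\<^sub>0 'a"

definition poly_ring :: "nat \<Rightarrow> 'a::comm_ring_1 mpol set" where
  "poly_ring n = {P. \<forall>m\<in>Poly_Mapping.keys P. Poly_Mapping.keys m \<subseteq> {..n}}"

definition peval :: "'a::comm_ring_1 mpol \<Rightarrow> (nat \<Rightarrow> 'a) \<Rightarrow> 'a" where
  "peval P x = (\<Sum>m\<in>Poly_Mapping.keys P. Poly_Mapping.lookup P m *
     (\<Prod>i\<in>Poly_Mapping.keys m. x i ^ Poly_Mapping.lookup m i))"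

text \<open>The zero polynomial is homogeneous of every degree.\<close>

definition homogeneous_deg :: "nat \<Rightarrow> 'a::comm_ring_1 mpol \<Rightarrow> bool" where
  "homogeneous_deg e P \<longleftrightarrow>
     (\<forall>m\<in>Poly_Mapping.keys P. (\<Sum>i\<in>Poly_Mapping.keys m. Poly_Mapping.lookup m i) = e)"

definition ideal_square :: "'a::comm_ring_1 mpol set \<Rightarrow> 'a mpol set" where
  "ideal_square J = {\<Sum>k<N. f k * g k | (N::nat) f g. \<forall>k<N. f k \<in> J \<and> g k \<in> J}"


section \<open>Projective space\<close>

text \<open>
  Vectors of \<open>K\<^sup>n\<^sup>+\<^sup>1\<close> are functions on \<open>nat\<close> vanishing beyond \<open>n\<close>.  A point of
  \<open>\<bbbP>\<^sup>n\<close> is an equivalence class of nonzero vectors, so that for a set \<open>U\<close> of points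
  the union \<open>\<Union>U\<close> is the punctured affine cone over \<open>U\<close>.
\<close>

definition nonzero_vecs :: "nat \<Rightarrow> (nat \<Rightarrow> 'a::field) set" where
  "nonzero_vecs n = {x. (\<forall>i>n. x i = 0) \<and> (\<exists>i\<le>n. x i \<noteq> 0)}"

definition proportional :: "nat \<Rightarrow> ((nat \<Rightarrow> 'a::field) \<times> (nat \<Rightarrow> 'a)) set" where
  "proportional n = {(x, y). x \<in> nonzero_vecs n \<and> y \<in> nonzero_vecs n \<and>
     (\<exists>c. c \<noteq> 0 \<and> y = (\<lambda>i. c * x i))}"

type_synonym 'a point = "(nat \<Rightarrow> 'a) set"

definition proj_space :: "nat \<Rightarrow> 'a::field point set" where
  "proj_space n = nonzero_vecs n // proportional n"

definition std_open :: "nat \<Rightarrow> nat \<Rightarrow> 'a::field point set" where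
  "std_open n i = {p \<in> proj_space n. \<forall>x\<in>p. x i \<noteq> 0}"

text \<open>The homogeneous ideal of a set of points (with its reduced structure).\<close>

definition vanishing_ideal :: "nat \<Rightarrow> 'a::field point set \<Rightarrow> 'a mpol set" where
  "vanishing_ideal n S = {f \<in> poly_ring n. \<forall>p\<in>S. \<forall>x\<in>p. peval f x = 0}"

text \<open>
  A homogeneous ideal of the scheme \<open>2S\<close>.  The ideal sheaf associated with the square of the
  homogeneous prime ideal of \<open>p\<close> has as its stalk at \<open>p\<close> the square of the maximal ideal of the
  local ring at \<open>p\<close>, and is the unit ideal at all other points.  A union of closed subschemes
  corresponds to the intersection of their ideals.
\<close>

definition double_points_ideal :: "nat \<Rightarrow> 'a::field point set \<Rightarrow> 'a mpol set" where
  "double_points_ideal n S =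
     {f \<in> poly_ring n. \<forall>p\<in>S. f \<in> ideal_square (vanishing_ideal n {p})}"


section \<open>Twisted ideal sheaves and their cohomology\<close>

text \<open>
  For a homogeneous ideal \<open>J\<close>, the sections over the open set \<open>U\<close> of the \<open>q\<close>-th twist of the
  ideal sheaf associated with \<open>J\<close> are the functions that are locally fractions \<open>A/B\<close> with
  \<open>A \<in> J\<close>, \<open>B\<close> homogeneous and \<open>deg A - deg B = q\<close>.  For \<open>q \<noteq> 0\<close> such a fraction is a
  function on the cone over \<open>U\<close> rather than on \<open>U\<close>; it is extended by zero.  As the sets where
  some homogeneous \<open>B\<close> does not vanish form a basis of the topology, such a set can be used as the
  neighbourhood of \<open>p\<close> (multiply \<open>A\<close> and \<open>B\<close> by a common factor).  The ideal
  \<open>J = poly_ring n\<close> yields the sheaf \<open>\<O>(q)\<close> itself.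
\<close>

definition sheaf_sections ::
  "nat \<Rightarrow> 'a::field mpol set \<Rightarrow> int \<Rightarrow> 'a point set \<Rightarrow> ((nat \<Rightarrow> 'a) \<Rightarrow> 'a) set" where
  "sheaf_sections n J q U = {s.
     (\<forall>x. x \<notin> \<Union>U \<longrightarrow> s x = 0) \<and>
     (\<forall>p\<in>U. \<exists>A B a b. A \<in> J \<and> B \<in> poly_ring n \<and>
        homogeneous_deg a A \<and> homogeneous_deg b B \<and> int a - int b = q \<and>
        (\<forall>x\<in>p. peval B x \<noteq> 0) \<and>
        (\<forall>x\<in>\<Union>U. peval B x \<noteq> 0 \<longrightarrow> s x = peval A x / peval B x))}"

text \<open>
  The dimension of \<open>Z/B\<close> for subspaces \<open>B \<subseteq> Z\<close> of a space of functions, as the supremum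
  of the sizes of the finite sets that are linearly independent modulo \<open>B\<close>.  In contrast to
  \<open>vector_space.dim\<close>, the value is \<open>\<infinity>\<close> and not \<open>0\<close> in the infinite-dimensional case.
\<close>

definition quotient_dim :: "('x \<Rightarrow> 'a::field) set \<Rightarrow> ('x \<Rightarrow> 'a) set \<Rightarrow> enat" where
  "quotient_dim Z B = (SUP T \<in> {T. finite T \<and> T \<subseteq> Z \<and>
      (\<forall>u. (\<lambda>x. \<Sum>t\<in>T. u t * t x) \<in> B \<longrightarrow> (\<forall>t\<in>T. u t = 0))}. enat (card T))"

definition h0 :: "nat \<Rightarrow> 'a::field mpol set \<Rightarrow> int \<Rightarrow> enat" where
  "h0 n J q = quotient_dim (sheaf_sections n J q (proj_space n)) {\<lambda>x. 0}"

text \<open>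
  \<open>H\<^sup>1\<close> is computed as Cech cohomology with respect to the standard affine open cover, using
  the complex of cochains indexed by all (not only increasing) tuples of indices.  The cochain
  \<open>c\<close> has as its component on the intersection of the \<open>i\<close>-th and the \<open>j\<close>-th open set the
  section \<open>\<lambda>x. c (i, j, x)\<close>.
\<close>

definition cech_cocycles1 ::
  "nat \<Rightarrow> 'a::field mpol set \<Rightarrow> int \<Rightarrow> (nat \<times> nat \<times> (nat \<Rightarrow> 'a) \<Rightarrow> 'a) set" where
  "cech_cocycles1 n J q = {c.
     (\<forall>i\<le>n. \<forall>j\<le>n. (\<lambda>x. c (i, j, x)) \<in> sheaf_sections n J q (std_open n i \<inter> std_open n j)) \<and>
     (\<forall>i j x. i > n \<or> j > n \<longrightarrow> c (i, j, x) = 0) \<and>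
     (\<forall>i\<le>n. \<forall>j\<le>n. \<forall>k\<le>n. \<forall>x\<in>\<Union>(std_open n i \<inter> std_open n j \<inter> std_open n k).
        c (j, k, x) - c (i, k, x) + c (i, j, x) = 0)}"

definition cech_coboundaries1 ::
  "nat \<Rightarrow> 'a::field mpol set \<Rightarrow> int \<Rightarrow> (nat \<times> nat \<times> (nat \<Rightarrow> 'a) \<Rightarrow> 'a) set" where
  "cech_coboundaries1 n J q =
     {\<lambda>(i, j, x). if i \<le> n \<and> j \<le> n \<and> x \<in> \<Union>(std_open n i \<inter> std_open n j)
                  then g j x - g i x else 0
      | g. \<forall>i\<le>n. g i \<in> sheaf_sections n J q (std_open n i)}"

definition h1 :: "nat \<Rightarrow> 'a::field mpol set \<Rightarrow> int \<Rightarrow> enat" where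
  "h1 n J q = quotient_dim (cech_cocycles1 n J q) (cech_coboundaries1 n J q)"


section \<open>Terracini loci\<close>

text \<open>
  The defining inequality \<open>h\<^sup>0(\<I>\<^sub>2\<^sub>S(d)) > h\<^sup>0(\<O>(d)) - (n+1)r\<close> is written without
  subtraction, because the right-hand side may be negative.
\<close>

definition terracini_locus :: "nat \<Rightarrow> nat \<Rightarrow> nat \<Rightarrow> 'a::field point set set" where
  "terracini_locus n d r = {S :: 'a point set. S \<subseteq> proj_space n \<and> finite S \<and> card S = r \<and>
     h0 n (double_points_ideal n S) (int d) + enat ((n + 1) * r) > h0 n (poly_ring n :: 'a mpol set) (int d)}"

end

theory Submission
  imports Defs "HOL-Computational_Algebra.Polynomial_FPS"
begin

text \<open>
  Vanishing of \<open>H\<^sup>1(\<I>\<^sub>S(q))\<close> implies that global sections of \<open>\<O>(q)\<close> can be prescribed on \<open>S\<close>. In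
  particular each \<open>p \<in> S\<close> has a section \<open>f\<^sub>p\<close> of \<open>\<O>(q)\<close> that is nonzero at \<open>p\<close> and zero at
  the other points of \<open>S\<close> (\<open>separating_section\<close>). The square of \<open>f\<^sub>p\<close> then vanishes doubly at
  those other points. As \<open>2 q < d\<close>, there is room to multiply it by a coordinate power \<open>x\<^sub>j\<^sup>k\<close> not
  vanishing at \<open>p\<close> and by one further coordinate \<open>x\<^sub>i\<close>, where \<open>2 q + k + 1 = d\<close>. The resulting
  \<open>(n + 1) r\<close> sections \<open>f\<^sub>p\<^sup>2 x\<^sub>j\<^sup>k x\<^sub>i\<close> of \<open>\<O>(d)\<close> are linearly independent modulo the sections of
  \<open>\<I>\<^sub>2\<^sub>S(d)\<close>: near \<open>p\<close> and to first order, a linear combination of them is a nonvanishing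
  function times a linear form, and a linear form that vanishes to second order is zero
  (\<open>first_order_independence\<close>). Hence
  \<open>h\<^sup>0(\<I>\<^sub>2\<^sub>S(d)) + (n + 1) r \<le> h\<^sup>0(\<O>(d))\<close> (\<open>quotient_dim_add_le\<close>).

  The sections \<open>f\<^sub>p\<close> are handled as functions that are locally fractions of forms, which makes
  the argument uniform in the sign of \<open>q\<close> and in \<open>n\<close>. To speak about vanishing to second order
  for such functions, they are expanded as formal power series along lines through a vector
  representing \<open>p\<close>.
\<close>

section \<open>Evaluation of polynomials and forms\<close>

lemma prod_power_monomial_add:
  fixes x :: "nat \<Rightarrow> 'b::comm_monoid_mult"
  shows "(\<Prod>i\<in>Poly_Mapping.keys (l + m). x i ^ Poly_Mapping.lookup (l + m) i) =
    (\<Prod>i\<in>Poly_Mapping.keys l. x i ^ Poly_Mapping.lookup l i) *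
    (\<Prod>i\<in>Poly_Mapping.keys m. x i ^ Poly_Mapping.lookup m i)"
proof -
  let ?K = "Poly_Mapping.keys l \<union> Poly_Mapping.keys m"
  have *: "(\<Prod>i\<in>Poly_Mapping.keys k. x i ^ Poly_Mapping.lookup k i) =
      (\<Prod>i\<in>?K. x i ^ Poly_Mapping.lookup k i)"
    if "Poly_Mapping.keys k \<subseteq> ?K" for k :: "nat \<Rightarrow>\<^sub>0 nat"
    by (rule prod.mono_neutral_left) (use that in \<open>auto simp: in_keys_iff\<close>)
  have "(\<Prod>i\<in>Poly_Mapping.keys (l + m). x i ^ Poly_Mapping.lookup (l + m) i) =
      (\<Prod>i\<in>?K. x i ^ Poly_Mapping.lookup (l + m) i)"
    by (rule *) (rule Poly_Mapping.keys_add)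
  also have "\<dots> = (\<Prod>i\<in>?K. x i ^ Poly_Mapping.lookup l i) * (\<Prod>i\<in>?K. x i ^ Poly_Mapping.lookup m i)"
    by (simp add: lookup_add power_add prod.distrib)
  finally show ?thesis by (simp add: *[of l] *[of m])
qed

lemma monomial_degree_add:
  fixes l m :: "nat \<Rightarrow>\<^sub>0 nat"
  shows "(\<Sum>i\<in>Poly_Mapping.keys (l + m). Poly_Mapping.lookup (l + m) i) =
    (\<Sum>i\<in>Poly_Mapping.keys l. Poly_Mapping.lookup l i) +
    (\<Sum>i\<in>Poly_Mapping.keys m. Poly_Mapping.lookup m i)"
proof -
  let ?K = "Poly_Mapping.keys l \<union> Poly_Mapping.keys m"
  have *: "(\<Sum>i\<in>Poly_Mapping.keys k. Poly_Mapping.lookup k i) = (\<Sum>i\<in>?K. Poly_Mapping.lookup k i)"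
    if "Poly_Mapping.keys k \<subseteq> ?K" for k :: "nat \<Rightarrow>\<^sub>0 nat"
    by (rule sum.mono_neutral_left) (use that in \<open>auto simp: in_keys_iff\<close>)
  show ?thesis
    using *[OF Poly_Mapping.keys_add] *[of l] *[of m] by (simp add: lookup_add sum.distrib)
qed

lemma peval_superset:
  assumes "finite K" "Poly_Mapping.keys P \<subseteq> K"
  shows "peval P x = (\<Sum>m\<in>K. Poly_Mapping.lookup P m *
     (\<Prod>i\<in>Poly_Mapping.keys m. x i ^ Poly_Mapping.lookup m i))"
  unfolding peval_def
  by (rule sum.mono_neutral_left) (use assms in \<open>auto simp: in_keys_iff\<close>)

lemma peval_add [simp]: "peval (P + Q) x = peval P x + peval Q x"
proof -
  let ?K = "Poly_Mapping.keys P \<union> Poly_Mapping.keys Q"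
  show ?thesis
    using Poly_Mapping.keys_add[of P Q]
    by (simp add: peval_superset[of ?K] lookup_add distrib_right sum.distrib)
qed

lemma peval_0 [simp]: "peval 0 x = 0"
  by (simp add: peval_def)

lemma peval_single:
  "peval (Poly_Mapping.single m c) x = c * (\<Prod>i\<in>Poly_Mapping.keys m. x i ^ Poly_Mapping.lookup m i)"
  by (simp add: peval_def)

lemma peval_sum: "peval (\<Sum>k\<in>I. f k) x = (\<Sum>k\<in>I. peval (f k) x)"
  by (induction I rule: infinite_finite_induct) auto

lemma mpol_eq_sum_single:
  fixes P :: "'a::comm_ring_1 mpol"
  shows "P = (\<Sum>m\<in>Poly_Mapping.keys P. Poly_Mapping.single m (Poly_Mapping.lookup P m))"
proof (rule poly_mapping_eqI)
  fix k
  have "Poly_Mapping.lookup (\<Sum>m\<in>Poly_Mapping.keys P. Poly_Mapping.single m (Poly_Mapping.lookup P m)) k =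
     (\<Sum>m\<in>Poly_Mapping.keys P. if m = k then Poly_Mapping.lookup P k else 0)"
    unfolding lookup_sum by (rule sum.cong) (auto simp: lookup_single when_def)
  then show "Poly_Mapping.lookup P k =
      Poly_Mapping.lookup (\<Sum>m\<in>Poly_Mapping.keys P. Poly_Mapping.single m (Poly_Mapping.lookup P m)) k"
    by (simp add: in_keys_iff)
qed

lemma peval_mult [simp]: "peval (P * Q) x = peval P x * peval Q x"
proof -
  let ?s = "\<lambda>P m. Poly_Mapping.single m (Poly_Mapping.lookup P m)"
  have "P * Q = (\<Sum>l\<in>Poly_Mapping.keys P. ?s P l) * (\<Sum>m\<in>Poly_Mapping.keys Q. ?s Q m)"
    by (rule arg_cong2[where f = "(*)", OF mpol_eq_sum_single mpol_eq_sum_single])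
  also have "peval \<dots> x = (\<Sum>l\<in>Poly_Mapping.keys P. peval (?s P l) x) * (\<Sum>m\<in>Poly_Mapping.keys Q. peval (?s Q m) x)"
    by (simp add: sum_product peval_sum mult_single peval_single prod_power_monomial_add mult_ac)
  also have "\<dots> = peval P x * peval Q x"
    by (simp add: peval_single peval_def[of P] peval_def[of Q])
  finally show ?thesis .
qed

definition form :: "nat \<Rightarrow> nat \<Rightarrow> 'a::comm_ring_1 mpol \<Rightarrow> bool" where
  "form n a A \<longleftrightarrow> A \<in> poly_ring n \<and> homogeneous_deg a A"

lemma form_add: "form n a A \<Longrightarrow> form n a B \<Longrightarrow> form n a (A + B)"
  using Poly_Mapping.keys_add[of A B] by (fastforce simp: form_def poly_ring_def homogeneous_deg_def)

lemma form_mult: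
  assumes "form n a A" "form n b B"
  shows "form n (a + b) (A * B)"
  unfolding form_def poly_ring_def homogeneous_deg_def mem_Collect_eq
proof (intro conjI ballI)
  fix k assume "k \<in> Poly_Mapping.keys (A * B)"
  then obtain l m where k: "k = l + m" "l \<in> Poly_Mapping.keys A" "m \<in> Poly_Mapping.keys B"
    using Poly_Mapping.keys_mult[of A B] by auto
  have "Poly_Mapping.keys l \<union> Poly_Mapping.keys m \<subseteq> {..n}"
    using k assms by (auto simp: form_def poly_ring_def)
  then show "Poly_Mapping.keys k \<subseteq> {..n}"
    using Poly_Mapping.keys_add[of l m] k by auto
  show "(\<Sum>i\<in>Poly_Mapping.keys k. Poly_Mapping.lookup k i) = a + b"
    using k assms by (simp add: monomial_degree_add form_def homogeneous_deg_def)
qed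

definition const :: "'a \<Rightarrow> 'a::comm_ring_1 mpol" where
  "const c = Poly_Mapping.single 0 c"

definition var :: "nat \<Rightarrow> 'a::comm_ring_1 mpol" where
  "var i = Poly_Mapping.single (Poly_Mapping.single i 1) 1"

lemma peval_const [simp]: "peval (const c) x = c"
  by (simp add: const_def peval_single)

lemma peval_var [simp]: "peval (var i) x = x i"
  by (simp add: var_def peval_single)

lemma form_const: "form n 0 (const c)"
  by (simp add: form_def const_def poly_ring_def homogeneous_deg_def)

lemma form_var: "i \<le> n \<Longrightarrow> form n 1 (var i)"
  by (simp add: form_def var_def poly_ring_def homogeneous_deg_def)

lemma form_smult: "form n a A \<Longrightarrow> form n a (const c * A)"
  using form_mult[OF form_const[of n c]] by fastforce

lemma form_power: "form n a A \<Longrightarrow> form n (k * a) (A ^ k)"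
proof (induction k)
  case 0
  have "(1 :: 'a mpol) = const 1" by (simp add: const_def)
  then show ?case using form_const[of n "1::'a"] by simp
next
  case (Suc k)
  then show ?case using form_mult[of n a A "k * a" "A ^ k"] by simp
qed

lemma peval_power [simp]: "peval (A ^ k) x = peval A x ^ k"
proof (induction k)
  case 0
  have "(1 :: 'a mpol) = const 1" by (simp add: const_def)
  then show ?case using peval_const[of "1::'a" x] by simp
qed simp

section \<open>Sections of twisted ideal sheaves\<close>

lemma fractionI:
  assumes "A \<in> J" "form n a A" "form n b B" "int a - int b = q" "\<forall>x\<in>p. peval B x \<noteq> 0"
    "\<forall>x\<in>\<Union>U. peval B x \<noteq> 0 \<longrightarrow> s x = peval A x / peval B x"
  shows "\<exists>A B a b. A \<in> J \<and> form n a A \<and> form n b B \<and> int a - int b = q \<and>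
      (\<forall>x\<in>p. peval B x \<noteq> 0) \<and>
      (\<forall>x\<in>\<Union>U. peval B x \<noteq> 0 \<longrightarrow> s x = peval A x / peval B x)"
  by (intro exI conjI) (fact assms)+

lemma sheaf_sectionsI:
  assumes "\<And>x. x \<notin> \<Union>U \<Longrightarrow> s x = 0"
    and "\<And>p. p \<in> U \<Longrightarrow> \<exists>A B a b. A \<in> J \<and> form n a A \<and> form n b B \<and> int a - int b = q \<and>
      (\<forall>x\<in>p. peval B x \<noteq> 0) \<and>
      (\<forall>x\<in>\<Union>U. peval B x \<noteq> 0 \<longrightarrow> s x = peval A x / peval B x)"
  shows "s \<in> sheaf_sections n J q U"
proof -
  have "\<exists>A B a b. A \<in> J \<and> B \<in> poly_ring n \<and>
      homogeneous_deg a A \<and> homogeneous_deg b B \<and> int a - int b = q \<and>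
      (\<forall>x\<in>p. peval B x \<noteq> 0) \<and>
      (\<forall>x\<in>\<Union>U. peval B x \<noteq> 0 \<longrightarrow> s x = peval A x / peval B x)" if "p \<in> U" for p
    using assms(2)[OF that] unfolding form_def by (elim exE conjE) (intro exI conjI; assumption)
  with assms(1) show ?thesis by (simp add: sheaf_sections_def)
qed

lemma sheaf_sectionsE:
  assumes "s \<in> sheaf_sections n J q U" "J \<subseteq> poly_ring n" "p \<in> U"
  obtains A a b B where "A \<in> J" "form n a A" "form n b B" "int a - int b = q"
    "\<forall>x\<in>p. peval B x \<noteq> 0"
    "\<forall>x\<in>\<Union>U. peval B x \<noteq> 0 \<longrightarrow> s x = peval A x / peval B x"
proof -
  obtain A B a b where *: "A \<in> J" "B \<in> poly_ring n" "homogeneous_deg a A" "homogeneous_deg b B"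
    "int a - int b = q" "\<forall>x\<in>p. peval B x \<noteq> 0"
    "\<forall>x\<in>\<Union>U. peval B x \<noteq> 0 \<longrightarrow> s x = peval A x / peval B x"
    using assms(1,3) unfolding sheaf_sections_def by fast
  show ?thesis
    by (rule that[of A a b B]) (use * assms(2) in \<open>auto simp: form_def\<close>)
qed

lemma sheaf_sections_outside: "s \<in> sheaf_sections n J q U \<Longrightarrow> x \<notin> \<Union>U \<Longrightarrow> s x = 0"
  by (simp add: sheaf_sections_def)

lemma sheaf_sections_mono:
  assumes "J \<subseteq> J'" "J' \<subseteq> poly_ring n"
  shows "sheaf_sections n J q U \<subseteq> sheaf_sections n J' q U"
proof
  fix s assume s: "s \<in> sheaf_sections n J q U"
  show "s \<in> sheaf_sections n J' q U"
  proof (rule sheaf_sectionsI, goal_cases)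
    case (1 x)
    then show ?case using s by (simp add: sheaf_sections_outside)
  next
    case (2 p)
    from assms have "J \<subseteq> poly_ring n" by simp
    from s \<open>J \<subseteq> poly_ring n\<close> 2 obtain A a b B where
      "A \<in> J" "form n a A" "form n b B" "int a - int b = q" "\<forall>x\<in>p. peval B x \<noteq> 0"
      "\<forall>x\<in>\<Union>U. peval B x \<noteq> 0 \<longrightarrow> s x = peval A x / peval B x" by (rule sheaf_sectionsE)
    with assms(1) show ?case
      by (intro fractionI[of A _ n a b B]) auto
  qed
qed

lemma sheaf_sections_restrict:
  assumes "s \<in> sheaf_sections n J q V" "J \<subseteq> poly_ring n" "U \<subseteq> V"
  shows "(\<lambda>x. if x \<in> \<Union>U then s x else 0) \<in> sheaf_sections n J q U"
proof (rule sheaf_sectionsI, goal_cases)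
  case (2 p)
  then have "p \<in> V" using assms by auto
  obtain A a b B where
    "A \<in> J" "form n a A" "form n b B" "int a - int b = q" "\<forall>x\<in>p. peval B x \<noteq> 0"
    "\<forall>x\<in>\<Union>V. peval B x \<noteq> 0 \<longrightarrow> s x = peval A x / peval B x" by (rule sheaf_sectionsE[OF assms(1,2) \<open>p \<in> V\<close>])
  moreover have "\<Union>U \<subseteq> \<Union>V" using assms by auto
  ultimately show ?case
    by (intro fractionI[of A _ n a b B]) auto
qed auto

lemma sheaf_sections_lincomb:
  assumes s: "s \<in> sheaf_sections n (poly_ring n) q U" and t: "t \<in> sheaf_sections n (poly_ring n) q U"
  shows "(\<lambda>x. k * s x + l * t x) \<in> sheaf_sections n (poly_ring n) q U"
proof (rule sheaf_sectionsI, goal_cases)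
  case (1 x)
  then show ?case using s t by (simp add: sheaf_sections_outside)
next
  case (2 p)
  obtain A a b B where A:
    "A \<in> poly_ring n" "form n a A" "form n b B" "int a - int b = q" "\<forall>x\<in>p. peval B x \<noteq> 0"
    "\<forall>x\<in>\<Union>U. peval B x \<noteq> 0 \<longrightarrow> s x = peval A x / peval B x" by (rule sheaf_sectionsE[OF s subset_refl 2])
  obtain C c d D where C:
    "C \<in> poly_ring n" "form n c C" "form n d D" "int c - int d = q" "\<forall>x\<in>p. peval D x \<noteq> 0"
    "\<forall>x\<in>\<Union>U. peval D x \<noteq> 0 \<longrightarrow> t x = peval C x / peval D x" by (rule sheaf_sectionsE[OF t subset_refl 2])
  have "b + c = a + d" using A(4) C(4) by simp
  then have N: "form n (a + d) (const k * (A * D) + const l * (B * C))"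
    using form_mult[OF A(2) C(3)] form_mult[OF A(3) C(2)]
    by (intro form_add form_smult) simp_all
  have "form n (b + d) (B * D)" by (intro form_mult A C)
  with N show ?case
    using A C
    by (intro fractionI[of "const k * (A * D) + const l * (B * C)" _ n "a + d" "b + d" "B * D"])
       (auto simp: form_def add_frac_eq)
qed

lemma sheaf_sections_mult:
  assumes s: "s \<in> sheaf_sections n (poly_ring n) q U" and t: "t \<in> sheaf_sections n (poly_ring n) q' U"
  shows "(\<lambda>x. s x * t x) \<in> sheaf_sections n (poly_ring n) (q + q') U"
proof (rule sheaf_sectionsI, goal_cases)
  case (1 x)
  then show ?case using s by (simp add: sheaf_sections_outside)
next
  case (2 p)
  obtain A a b B where A:
    "A \<in> poly_ring n" "form n a A" "form n b B" "int a - int b = q" "\<forall>x\<in>p. peval B x \<noteq> 0"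
    "\<forall>x\<in>\<Union>U. peval B x \<noteq> 0 \<longrightarrow> s x = peval A x / peval B x" by (rule sheaf_sectionsE[OF s subset_refl 2])
  obtain C c d D where C:
    "C \<in> poly_ring n" "form n c C" "form n d D" "int c - int d = q'" "\<forall>x\<in>p. peval D x \<noteq> 0"
    "\<forall>x\<in>\<Union>U. peval D x \<noteq> 0 \<longrightarrow> t x = peval C x / peval D x" by (rule sheaf_sectionsE[OF t subset_refl 2])
  have "form n (a + c) (A * C)" "form n (b + d) (B * D)" by (intro form_mult A C)+
  then show ?case
    using A C
    by (intro fractionI[of "A * C" _ n "a + c" "b + d" "B * D"])
       (auto simp: form_def)
qed

lemma sheaf_sections_form:
  assumes "form n a A"
  shows "(\<lambda>x. if x \<in> \<Union>U then peval A x else 0) \<in> sheaf_sections n (poly_ring n) (int a) U"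
proof (rule sheaf_sectionsI, goal_cases)
  case (2 p)
  show ?case
    by (intro fractionI[of A _ n a 0 "const 1"])
       (use assms form_const[of n 1] in \<open>auto simp: form_def\<close>)
qed auto

section \<open>Points and standard open sets\<close>

lemma mem_Union_proj_space: "x \<in> \<Union>(proj_space n) \<longleftrightarrow> x \<in> nonzero_vecs n" 
  for x :: "nat \<Rightarrow> 'a::field"
proof
  show "x \<in> nonzero_vecs n" if "x \<in> \<Union>(proj_space n)"
    using that by (auto simp: proj_space_def quotient_def proportional_def)
next
  assume x: "x \<in> nonzero_vecs n"
  then have "(x, x) \<in> proportional n"
    by (auto simp: proportional_def intro!: exI[of _ 1])
  with x show "x \<in> \<Union>(proj_space n)"
    by (auto simp: proj_space_def quotient_def)
qed

lemma point_eq: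
  assumes "p \<in> proj_space n" "x \<in> p"
  shows "p = {(\<lambda>i. c * x i) | c. c \<noteq> 0}" and "x \<in> nonzero_vecs n"
proof -
  from assms(1) obtain z where z: "z \<in> nonzero_vecs n" "p = proportional n `` {z}"
    by (auto simp: proj_space_def quotient_def)
  with assms(2) obtain c where c: "c \<noteq> 0" "x = (\<lambda>i. c * z i)" "x \<in> nonzero_vecs n"
    by (auto simp: proportional_def)
  then show "x \<in> nonzero_vecs n" by simp
  have scale: "(\<lambda>i. k * z i) \<in> nonzero_vecs n" if "k \<noteq> 0" for k
    using z(1) that by (auto simp: nonzero_vecs_def)
  show "p = {(\<lambda>i. c * x i) | c. c \<noteq> 0}"
  proof (intro set_eqI iffI)
    fix y assume "y \<in> p"
    then obtain k where "k \<noteq> 0" "y = (\<lambda>i. k * z i)"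
      using z by (auto simp: proportional_def)
    then have "y = (\<lambda>i. (k / c) * x i)" "k / c \<noteq> 0" using c by auto
    then show "y \<in> {(\<lambda>i. c * x i) | c. c \<noteq> 0}" by blast
  next
    fix y assume "y \<in> {(\<lambda>i. c * x i) | c. c \<noteq> 0}"
    then obtain k where "k \<noteq> 0" "y = (\<lambda>i. (k * c) * z i)"
      using c by (auto simp: mult.assoc)
    then have "k * c \<noteq> 0 \<and> y = (\<lambda>i. (k * c) * z i)" using c(1) by simp
    then have "\<exists>l. l \<noteq> 0 \<and> y = (\<lambda>i. l * z i)" by blast
    then show "y \<in> p"
      using z scale by (auto simp: proportional_def)
  qed
qed

lemma point_nonempty: "p \<in> proj_space n \<Longrightarrow> \<exists>x. x \<in> p" for p :: "'a::field point"
proof -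
  assume "p \<in> proj_space n"
  then obtain z where z: "z \<in> nonzero_vecs n" "p = proportional n `` {z}"
    by (auto simp: proj_space_def quotient_def)
  then have "(z, z) \<in> proportional n"
    by (auto simp: proportional_def intro!: exI[of _ 1])
  then show ?thesis using z by auto
qed

lemma points_disjoint:
  assumes "p \<in> proj_space n" "p' \<in> proj_space n" "x \<in> p" "x \<in> p'"
  shows "p = p'"
  using point_eq(1)[OF assms(1,3)] point_eq(1)[OF assms(2,4)] by simp

lemma mem_std_open_iff:
  assumes "p \<in> proj_space n" "x \<in> p"
  shows "p \<in> std_open n i \<longleftrightarrow> x i \<noteq> 0"
  using assms(1) point_eq(1)[OF assms] assms(2) by (auto simp: std_open_def)

lemma mem_Union_std_open: "x \<in> \<Union>(std_open n i) \<longleftrightarrow> x \<in> nonzero_vecs n \<and> x i \<noteq> 0"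
proof
  assume "x \<in> \<Union>(std_open n i)"
  then show "x \<in> nonzero_vecs n \<and> x i \<noteq> 0"
    using mem_Union_proj_space[of x n] by (auto simp: std_open_def)
next
  assume "x \<in> nonzero_vecs n \<and> x i \<noteq> 0"
  then obtain p where "p \<in> proj_space n" "x \<in> p" using mem_Union_proj_space[of x n] by auto
  with \<open>x \<in> nonzero_vecs n \<and> x i \<noteq> 0\<close> mem_std_open_iff show "x \<in> \<Union>(std_open n i)" by blast
qed

lemma mem_Union_std_open_Int:
  "x \<in> \<Union>(std_open n i \<inter> std_open n j) \<longleftrightarrow> x \<in> nonzero_vecs n \<and> x i \<noteq> 0 \<and> x j \<noteq> 0"
proof
  assume "x \<in> \<Union>(std_open n i \<inter> std_open n j)"
  then show "x \<in> nonzero_vecs n \<and> x i \<noteq> 0 \<and> x j \<noteq> 0"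
    using mem_Union_std_open[of x n i] mem_Union_std_open[of x n j] by auto
next
  assume *: "x \<in> nonzero_vecs n \<and> x i \<noteq> 0 \<and> x j \<noteq> 0"
  then obtain p where "p \<in> proj_space n" "x \<in> p" using mem_Union_proj_space[of x n] by auto
  with * mem_std_open_iff show "x \<in> \<Union>(std_open n i \<inter> std_open n j)" by blast
qed

lemma vanishing_ideal_subset: "vanishing_ideal n S \<subseteq> poly_ring n"
  by (auto simp: vanishing_ideal_def)

section \<open>Expansions along lines\<close>

definition line_poly :: "'a::comm_ring_1 mpol \<Rightarrow> (nat \<Rightarrow> 'a) \<Rightarrow> (nat \<Rightarrow> 'a) \<Rightarrow> 'a poly" where
  "line_poly A x v = (\<Sum>m\<in>Poly_Mapping.keys A. smult (Poly_Mapping.lookup A m)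
     (\<Prod>i\<in>Poly_Mapping.keys m. [:x i, v i:] ^ Poly_Mapping.lookup m i))"

lemma poly_line_poly [simp]: "poly (line_poly A x v) t = peval A (\<lambda>i. x i + t * v i)"
  by (simp add: line_poly_def peval_def poly_sum poly_prod)

text \<open>
  \<open>\<phi>\<close> is the Taylor series at \<open>t = 0\<close> of the function \<open>t \<mapsto> s (x + t v)\<close>, which is required to agree
  with a rational function \<open>P / Q\<close> regular at \<open>0\<close>. No condition is imposed at the finitely many
  zeros of \<open>Q\<close>; so \<open>Q\<close> can be multiplied by a factor that excludes unwanted parameters \<open>t\<close>.
\<close>

definition expands :: "((nat \<Rightarrow> 'a::field) \<Rightarrow> 'a) \<Rightarrow> (nat \<Rightarrow> 'a) \<Rightarrow> (nat \<Rightarrow> 'a) \<Rightarrow> 'a fps \<Rightarrow> bool" where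
  "expands s x v \<phi> \<longleftrightarrow> (\<exists>P Q. poly Q 0 \<noteq> 0 \<and> \<phi> * fps_of_poly Q = fps_of_poly P \<and>
     (\<forall>t. poly Q t \<noteq> 0 \<longrightarrow> s (\<lambda>i. x i + t * v i) * poly Q t = poly P t))"

lemma expandsI:
  assumes "poly Q 0 \<noteq> 0" "\<phi> * fps_of_poly Q = fps_of_poly P"
    "\<And>t. poly Q t \<noteq> 0 \<Longrightarrow> s (\<lambda>i. x i + t * v i) * poly Q t = poly P t"
  shows "expands s x v \<phi>"
  using assms unfolding expands_def by blast

lemma expands_add:
  assumes "expands s x v \<phi>" "expands t x v \<psi>"
  shows "expands (\<lambda>y. s y + t y) x v (\<phi> + \<psi>)"
proof -
  obtain P Q where 1: "poly Q 0 \<noteq> 0" "\<phi> * fps_of_poly Q = fps_of_poly P"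
    "\<forall>u. poly Q u \<noteq> 0 \<longrightarrow> s (\<lambda>i. x i + u * v i) * poly Q u = poly P u"
    using assms(1) unfolding expands_def by auto
  obtain R T where 2: "poly T 0 \<noteq> 0" "\<psi> * fps_of_poly T = fps_of_poly R"
    "\<forall>u. poly T u \<noteq> 0 \<longrightarrow> t (\<lambda>i. x i + u * v i) * poly T u = poly R u"
    using assms(2) unfolding expands_def by auto
  show ?thesis
  proof (rule expandsI)
    show "poly (Q * T) 0 \<noteq> 0" using 1 2 by simp
    have "(\<phi> + \<psi>) * fps_of_poly (Q * T) =
        (\<phi> * fps_of_poly Q) * fps_of_poly T + (\<psi> * fps_of_poly T) * fps_of_poly Q"
      by (simp add: fps_of_poly_mult algebra_simps)
    then show "(\<phi> + \<psi>) * fps_of_poly (Q * T) = fps_of_poly (P * T + R * Q)"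
      by (simp only: 1 2 fps_of_poly_mult fps_of_poly_add)
  next
    fix u assume "poly (Q * T) u \<noteq> 0"
    then have e: "s (\<lambda>i. x i + u * v i) * poly Q u = poly P u" "t (\<lambda>i. x i + u * v i) * poly T u = poly R u"
      using 1 2 by auto
    then show "(s (\<lambda>i. x i + u * v i) + t (\<lambda>i. x i + u * v i)) * poly (Q * T) u = poly (P * T + R * Q) u"
      by (simp add: algebra_simps flip: e)
  qed
qed

lemma expands_mult:
  assumes "expands s x v \<phi>" "expands t x v \<psi>"
  shows "expands (\<lambda>y. s y * t y) x v (\<phi> * \<psi>)"
proof -
  obtain P Q where 1: "poly Q 0 \<noteq> 0" "\<phi> * fps_of_poly Q = fps_of_poly P"
    "\<forall>u. poly Q u \<noteq> 0 \<longrightarrow> s (\<lambda>i. x i + u * v i) * poly Q u = poly P u"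
    using assms(1) unfolding expands_def by auto
  obtain R T where 2: "poly T 0 \<noteq> 0" "\<psi> * fps_of_poly T = fps_of_poly R"
    "\<forall>u. poly T u \<noteq> 0 \<longrightarrow> t (\<lambda>i. x i + u * v i) * poly T u = poly R u"
    using assms(2) unfolding expands_def by auto
  show ?thesis
  proof (rule expandsI)
    show "poly (Q * T) 0 \<noteq> 0" using 1 2 by simp
    have "(\<phi> * \<psi>) * fps_of_poly (Q * T) = (\<phi> * fps_of_poly Q) * (\<psi> * fps_of_poly T)"
      by (simp add: fps_of_poly_mult algebra_simps)
    then show "(\<phi> * \<psi>) * fps_of_poly (Q * T) = fps_of_poly (P * R)"
      by (simp only: 1 2 fps_of_poly_mult)
  next
    fix u assume "poly (Q * T) u \<noteq> 0"
    then have e: "s (\<lambda>i. x i + u * v i) * poly Q u = poly P u" "t (\<lambda>i. x i + u * v i) * poly T u = poly R u"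
      using 1 2 by auto
    then show "s (\<lambda>i. x i + u * v i) * t (\<lambda>i. x i + u * v i) * poly (Q * T) u = poly (P * R) u"
      by (simp add: algebra_simps flip: e)
  qed
qed

lemma expands_const: "expands (\<lambda>y. c) x v (fps_const c)"
  by (rule expandsI[where Q = 1 and P = "[:c:]"]) (auto simp: fps_of_poly_const)

lemma expands_coordinate: "expands (\<lambda>y. y i) x v (fps_of_poly [:x i, v i:])"
  by (rule expandsI[where Q = 1 and P = "[:x i, v i:]"]) auto

lemma expands_power: "expands s x v \<phi> \<Longrightarrow> expands (\<lambda>y. s y ^ k) x v (\<phi> ^ k)"
proof (induction k)
  case 0
  then show ?case using expands_const[of 1] by simp
next
  case (Suc k)
  then show ?case using expands_mult[of s x v \<phi>] by simp
qed

lemma expands_sum: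
  "(\<And>k. k \<in> I \<Longrightarrow> expands (s k) x v (\<phi> k)) \<Longrightarrow>
    expands (\<lambda>y. \<Sum>k\<in>I. s k y) x v (\<Sum>k\<in>I. \<phi> k)"
proof (induction I rule: infinite_finite_induct)
  case (insert k I)
  then show ?case using expands_add[of "s k" x v "\<phi> k"] by simp
qed (use expands_const[of 0] in auto)

lemma expands_at_0: "expands s x v \<phi> \<Longrightarrow> fps_nth \<phi> 0 = s x"
proof -
  assume "expands s x v \<phi>"
  then obtain P Q where 1: "poly Q 0 \<noteq> 0" "\<phi> * fps_of_poly Q = fps_of_poly P"
    "\<forall>u. poly Q u \<noteq> 0 \<longrightarrow> s (\<lambda>i. x i + u * v i) * poly Q u = poly P u"
    unfolding expands_def by auto
  have "fps_nth \<phi> 0 * poly Q 0 = poly P 0"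
    using arg_cong[OF 1(2), of "\<lambda>f. fps_nth f 0"] by (simp add: poly_0_coeff_0)
  moreover have "s x * poly Q 0 = poly P 0" using 1(1) 1(3)[rule_format, of 0] by simp
  ultimately show ?thesis using 1(1) by (metis mult_right_cancel)
qed

text \<open>
  Two rational functions that agree outside the zeros of their denominators are equal, because
  a field of characteristic \<open>0\<close> has infinitely many elements.
\<close>

lemma expands_unique:
  fixes s :: "(nat \<Rightarrow> 'a::field_char_0) \<Rightarrow> 'a"
  assumes "expands s x v \<phi>" "expands s x v \<psi>"
  shows "\<phi> = \<psi>"
proof -
  obtain P Q where 1: "poly Q 0 \<noteq> 0" "\<phi> * fps_of_poly Q = fps_of_poly P"
    "\<forall>u. poly Q u \<noteq> 0 \<longrightarrow> s (\<lambda>i. x i + u * v i) * poly Q u = poly P u"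
    using assms(1) unfolding expands_def by auto
  obtain R T where 2: "poly T 0 \<noteq> 0" "\<psi> * fps_of_poly T = fps_of_poly R"
    "\<forall>u. poly T u \<noteq> 0 \<longrightarrow> s (\<lambda>i. x i + u * v i) * poly T u = poly R u"
    using assms(2) unfolding expands_def by auto
  have "poly ((P * T - R * Q) * (Q * T)) u = 0" for u
  proof (cases "poly (Q * T) u = 0")
    case False
    then have e: "s (\<lambda>i. x i + u * v i) * poly Q u = poly P u" "s (\<lambda>i. x i + u * v i) * poly T u = poly R u"
      using 1 2 by auto
    then show ?thesis by (simp flip: e)
  qed auto
  then have "(P * T - R * Q) * (Q * T) = 0" by (intro poly_eq_poly_eq_iff[THEN iffD1] ext) simp
  moreover have nz: "Q \<noteq> 0" "T \<noteq> 0" using 1 2 by auto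
  ultimately have PR: "P * T = R * Q" by simp
  have "\<phi> * fps_of_poly (Q * T) = fps_of_poly (P * T)"
    by (simp add: fps_of_poly_mult flip: 1(2) mult.assoc)
  also have "\<dots> = \<psi> * fps_of_poly (Q * T)"
    unfolding PR by (simp add: fps_of_poly_mult flip: 2(2))
  finally have "\<phi> * fps_of_poly (Q * T) = \<psi> * fps_of_poly (Q * T)" .
  moreover have "fps_of_poly (Q * T) \<noteq> 0" using nz by simp
  ultimately show ?thesis by simp
qed

text \<open>
  The line through \<open>x\<close> may pass through the zero vector, which represents no point, so
  that the local fraction need not describe \<open>s\<close> there. Since some
  coordinate \<open>x i\<close> is nonzero, the denominator is multiplied by the \<open>i\<close>-th coordinate along the
  line, which excludes that parameter.
\<close>

lemma section_expands:
  assumes s: "s \<in> sheaf_sections n J q (proj_space n)" and J: "J \<subseteq> poly_ring n"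
    and p: "p \<in> proj_space n" "x \<in> p" and v: "\<forall>i>n. v i = 0"
  obtains A B \<phi> where "A \<in> J" "peval B x \<noteq> 0" "expands s x v \<phi>"
    "\<phi> * fps_of_poly (line_poly B x v) = fps_of_poly (line_poly A x v)"
proof -
  obtain A a b B where A: "A \<in> J" "form n a A" "form n b B" "int a - int b = q"
    "\<forall>x\<in>p. peval B x \<noteq> 0"
    "\<forall>x\<in>\<Union>(proj_space n). peval B x \<noteq> 0 \<longrightarrow> s x = peval A x / peval B x"
    by (rule sheaf_sectionsE[OF s J p(1)])
  have x: "x \<in> nonzero_vecs n" by (rule point_eq(2)[OF p])
  then obtain i where i: "x i \<noteq> 0" "i \<le> n" by (auto simp: nonzero_vecs_def)
  let ?L = "[:x i, v i:]"
  have B0: "peval B x \<noteq> 0" using A p by auto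
  define \<phi> where "\<phi> = fps_of_poly (line_poly A x v) * inverse (fps_of_poly (line_poly B x v))"
  have "fps_nth (fps_of_poly (line_poly B x v)) 0 \<noteq> 0"
    using B0 poly_line_poly[of B x v 0] by (simp add: poly_0_coeff_0)
  then have \<phi>: "\<phi> * fps_of_poly (line_poly B x v) = fps_of_poly (line_poly A x v)"
    by (simp add: \<phi>_def mult.assoc inverse_mult_eq_1)
  have "expands s x v \<phi>"
  proof (rule expandsI)
    show "poly (line_poly B x v * ?L) 0 \<noteq> 0" using B0 i by simp
    show "\<phi> * fps_of_poly (line_poly B x v * ?L) = fps_of_poly (line_poly A x v * ?L)"
      by (simp only: fps_of_poly_mult \<phi> flip: mult.assoc)
  next
    fix t assume t: "poly (line_poly B x v * ?L) t \<noteq> 0"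
    then have "poly (line_poly B x v) t \<noteq> 0" "poly ?L t \<noteq> 0"
      by (simp_all only: poly_mult mult_eq_0_iff de_Morgan_disj simp_thms)
    then have t: "peval B (\<lambda>i. x i + t * v i) \<noteq> 0" "x i + t * v i \<noteq> 0" by simp_all
    then have "(\<lambda>i. x i + t * v i) \<in> nonzero_vecs n"
      using i v x by (auto simp: nonzero_vecs_def)
    then have "(\<lambda>i. x i + t * v i) \<in> \<Union>(proj_space n)" by (simp only: mem_Union_proj_space)
    with A(6) t have "s (\<lambda>i. x i + t * v i) * peval B (\<lambda>i. x i + t * v i) = peval A (\<lambda>i. x i + t * v i)"
      by auto
    then show "s (\<lambda>i. x i + t * v i) * poly (line_poly B x v * ?L) t = poly (line_poly A x v * ?L) t"
      by (simp only: poly_mult poly_line_poly flip: mult.assoc)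
  qed
  then show ?thesis using that[OF A(1) B0 _ \<phi>] by simp
qed

lemma double_points_ideal_subset: "double_points_ideal n S \<subseteq> poly_ring n"
  by (auto simp: double_points_ideal_def)

text \<open>
  Each summand of \<open>A\<close> is a product of two polynomials without constant term along the line.
\<close>

lemma line_poly_ideal_square:
  fixes x :: "nat \<Rightarrow> 'a::field_char_0"
  assumes "A \<in> ideal_square (vanishing_ideal n {p})" "x \<in> p"
  shows "coeff (line_poly A x v) 0 = 0" "coeff (line_poly A x v) 1 = 0"
proof -
  obtain N :: nat and f g where A: "A = (\<Sum>k<N. f k * g k)"
    and fg: "\<forall>k<N. f k \<in> vanishing_ideal n {p} \<and> g k \<in> vanishing_ideal n {p}"
    using assms(1) by (auto simp: ideal_square_def)
  have eq: "line_poly A x v = (\<Sum>k<N. line_poly (f k) x v * line_poly (g k) x v)"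
    by (intro poly_eq_poly_eq_iff[THEN iffD1] ext) (simp add: A poly_sum peval_sum)
  have "coeff (line_poly (f k) x v) 0 = 0 \<and> coeff (line_poly (g k) x v) 0 = 0" if "k < N" for k
    using fg that assms(2) poly_line_poly[of "f k" x v 0] poly_line_poly[of "g k" x v 0]
    by (auto simp: vanishing_ideal_def poly_0_coeff_0)
  then show "coeff (line_poly A x v) 0 = 0" "coeff (line_poly A x v) 1 = 0"
    unfolding eq by (simp_all add: coeff_sum coeff_mult)
qed

text \<open>
  Vanishing to second order at all points of \<open>S\<close>, tested on lines through all vectors of the cone
  over \<open>S\<close>. Independence modulo \<open>\<I>\<^sub>2\<^sub>S(d)\<close> is deduced from independence modulo this condition,
  which is decided by two coefficients of a power series.
\<close>

definition vanishes_doubly :: "nat \<Rightarrow> 'a::field point set \<Rightarrow> ((nat \<Rightarrow> 'a) \<Rightarrow> 'a) \<Rightarrow> bool" where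
  "vanishes_doubly n S s \<longleftrightarrow> (\<forall>x\<in>\<Union>S. \<forall>v. (\<forall>i>n. v i = 0) \<longrightarrow>
     (\<exists>\<phi>. expands s x v \<phi> \<and> fps_nth \<phi> 0 = 0 \<and> fps_nth \<phi> 1 = 0))"

lemma double_section_vanishes_doubly:
  fixes S :: "'a::field_char_0 point set"
  assumes S: "S \<subseteq> proj_space n"
    and s: "s \<in> sheaf_sections n (double_points_ideal n S) q (proj_space n)"
  shows "vanishes_doubly n S s"
  unfolding vanishes_doubly_def
proof (intro ballI allI impI)
  fix x v assume x: "x \<in> \<Union>S" and v: "\<forall>i>n. (v i :: 'a) = 0"
  from x obtain p where p: "p \<in> S" "x \<in> p" by auto
  obtain A B \<phi> where *: "A \<in> double_points_ideal n S" "peval B x \<noteq> 0" "expands s x v \<phi>"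
    "\<phi> * fps_of_poly (line_poly B x v) = fps_of_poly (line_poly A x v)"
    using section_expands[OF s double_points_ideal_subset _ p(2) v] p S by blast
  have B: "coeff (line_poly B x v) 0 \<noteq> 0"
    using *(2) poly_line_poly[of B x v 0] by (simp add: poly_0_coeff_0)
  have "A \<in> ideal_square (vanishing_ideal n {p})"
    using *(1) p by (simp add: double_points_ideal_def)
  note A = line_poly_ideal_square[OF this p(2), of v]
  have 0: "fps_nth \<phi> 0 = 0"
    using arg_cong[OF *(4), of "\<lambda>f. fps_nth f 0"] A B by simp
  have "fps_nth \<phi> 1 = 0"
    using arg_cong[OF *(4), of "\<lambda>f. fps_nth f 1"] A B 0 by (simp add: fps_mult_nth_1)
  with 0 *(3) show "\<exists>\<phi>. expands s x v \<phi> \<and> fps_nth \<phi> 0 = 0 \<and> fps_nth \<phi> 1 = 0" by blast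
qed

lemma vanishes_doubly_sum:
  fixes c :: "'i \<Rightarrow> 'a::field"
  assumes "\<And>k. k \<in> I \<Longrightarrow> vanishes_doubly n S (s k)"
  shows "vanishes_doubly n S (\<lambda>y. \<Sum>k\<in>I. c k * s k y)"
  unfolding vanishes_doubly_def
proof (intro ballI allI impI)
  fix x v assume x: "x \<in> \<Union>S" and v: "\<forall>i>n. (v i :: 'a) = 0"
  have "\<forall>k. \<exists>\<phi>. k \<in> I \<longrightarrow> expands (s k) x v \<phi> \<and> fps_nth \<phi> 0 = 0 \<and> fps_nth \<phi> 1 = 0"
    using assms x v unfolding vanishes_doubly_def by blast
  then obtain \<phi> where \<phi>: "\<And>k. k \<in> I \<Longrightarrow> expands (s k) x v (\<phi> k) \<and> fps_nth (\<phi> k) 0 = 0 \<and> fps_nth (\<phi> k) 1 = 0"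
    by metis
  have "expands (\<lambda>y. \<Sum>k\<in>I. c k * s k y) x v (\<Sum>k\<in>I. fps_const (c k) * \<phi> k)"
    using \<phi> by (intro expands_sum expands_mult expands_const) auto
  then show "\<exists>\<phi>. expands (\<lambda>y. \<Sum>k\<in>I. c k * s k y) x v \<phi> \<and> fps_nth \<phi> 0 = 0 \<and> fps_nth \<phi> 1 = 0"
    using \<phi> by (intro exI[of _ "\<Sum>k\<in>I. fps_const (c k) * \<phi> k"]) (simp add: fps_sum_nth)
qed

section \<open>Separating the points of a set by sections\<close>

text \<open>
  For a single point \<open>[y]\<close> different from \<open>[x]\<close>, some minor \<open>y\<^sub>j x\<^sub>i - y\<^sub>i x\<^sub>j\<close> is nonzero, so that the
  linear form \<open>y\<^sub>j X\<^sub>i - y\<^sub>i X\<^sub>j\<close> vanishes at \<open>y\<close> but not at \<open>x\<close>. In general one multiplies such forms.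
\<close>

lemma separating_form:
  fixes p :: "'a::field point"
  assumes "finite F" "F \<subseteq> proj_space n" "p \<in> proj_space n" "p \<notin> F"
  shows "\<exists>A m. form n m A \<and> (\<forall>x\<in>p. peval A x \<noteq> 0) \<and> (\<forall>y\<in>\<Union>F. peval A y = 0)"
  using assms
proof (induction F rule: finite_induct)
  case empty
  show ?case using form_const[of n "1::'a"] by (intro exI[of _ "const 1"] exI[of _ 0]) auto
next
  case (insert p' F)
  then obtain A m where A: "form n m A" "\<forall>x\<in>p. peval A x \<noteq> 0" "\<forall>y\<in>\<Union>F. peval A y = 0"
    by auto
  have p': "p' \<in> proj_space n" using insert by auto
  obtain x y where x: "x \<in> p" and y: "y \<in> p'"
    using point_nonempty insert.prems by blast
  have nz: "x \<in> nonzero_vecs n" "y \<in> nonzero_vecs n"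
    using point_eq(2) x y p' insert.prems by blast+
  have "\<exists>i\<le>n. \<exists>j\<le>n. y j * x i \<noteq> y i * x j"
  proof (rule ccontr)
    assume "\<not> ?thesis"
    then have eq: "y j * x i = y i * x j" if "i \<le> n" "j \<le> n" for i j using that by blast
    obtain j where j: "j \<le> n" "y j \<noteq> 0" using nz by (auto simp: nonzero_vecs_def)
    have x_eq: "x = (\<lambda>i. (x j / y j) * y i)"
    proof
      fix i show "x i = (x j / y j) * y i"
        using eq[of i j] j nz by (cases "i \<le> n") (auto simp: nonzero_vecs_def field_simps)
    qed
    have "x j \<noteq> 0"
    proof
      assume "x j = 0"
      then have "x i = 0" for i using fun_cong[OF x_eq, of i] by simp
      then show False using nz by (auto simp: nonzero_vecs_def)
    qed
    then have "x j / y j \<noteq> 0" using j by simp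
    then have "x \<in> p'" using point_eq(1)[OF p' y] x_eq by blast
    then have "p = p'" using points_disjoint insert.prems p' x by blast
    then show False using insert.prems by simp
  qed
  then obtain i j where ij: "i \<le> n" "j \<le> n" "y j * x i \<noteq> y i * x j" by blast
  let ?L = "const (y j) * var i + const (- y i) * var j"
  have L: "form n 1 ?L" by (intro form_add form_smult form_var ij)
  have "peval ?L z \<noteq> 0" if z: "z \<in> p" for z
  proof -
    obtain c where c: "c \<noteq> 0" "z = (\<lambda>i. c * x i)"
      using z point_eq(1)[OF insert.prems(2) x] by auto
    then have "peval ?L z = c * (y j * x i - y i * x j)" by (simp add: algebra_simps)
    then show ?thesis using c ij by simp
  qed
  moreover have "peval ?L z = 0" if z: "z \<in> p'" for z
    using z point_eq(1)[OF p' y] by auto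
  ultimately show ?case
    using A form_mult[OF A(1) L] by (intro exI[of _ "A * ?L"] exI[of _ "m + 1"]) auto
qed

text \<open>
  In a local representation \<open>A / B\<close> of \<open>s\<close> the numerator vanishes at those points of \<open>S\<close> where \<open>B\<close>
  is nonzero and which lie in the open set. Multiplying \<open>A\<close> and \<open>B\<close> by \<open>B x\<^sub>i x\<^sub>j\<close> makes
  the numerator vanish at the remaining points of \<open>S\<close> too.
\<close>

lemma section_in_vanishing_ideal:
  fixes S :: "'a::field point set"
  assumes S: "S \<subseteq> proj_space n" and ij: "i \<le> n" "j \<le> n"
    and s: "s \<in> sheaf_sections n (poly_ring n) q (std_open n i \<inter> std_open n j)" (is "_ \<in> sheaf_sections _ _ _ ?U")
    and van: "\<forall>x\<in>\<Union>S. s x = 0"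
  shows "s \<in> sheaf_sections n (vanishing_ideal n S) q ?U"
proof (rule sheaf_sectionsI, goal_cases)
  case (1 x)
  then show ?case using s by (simp add: sheaf_sections_outside)
next
  case (2 p)
  obtain A a b B where A:
    "A \<in> poly_ring n" "form n a A" "form n b B" "int a - int b = q" "\<forall>x\<in>p. peval B x \<noteq> 0"
    "\<forall>x\<in>\<Union>?U. peval B x \<noteq> 0 \<longrightarrow> s x = peval A x / peval B x"
    by (rule sheaf_sectionsE[OF s subset_refl 2])
  let ?H = "B * (var i * var j)"
  have H: "form n (b + (1 + 1)) ?H" by (intro form_mult form_var A ij)
  note AH = form_mult[OF A(2) H] and BH = form_mult[OF A(3) H]
  have "peval (A * ?H) y = 0" if y: "y \<in> \<Union>S" for y
  proof (cases "y \<in> \<Union>?U \<and> peval B y \<noteq> 0")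
    case True
    then have "peval A y = s y * peval B y" using A(6) by auto
    moreover have "s y = 0" using van y by blast
    ultimately show ?thesis by simp
  next
    case False
    have "y \<in> nonzero_vecs n" using y S mem_Union_proj_space[of y n] by auto
    with False have "peval B y = 0 \<or> y i = 0 \<or> y j = 0" by (auto simp only: mem_Union_std_open_Int)
    then show ?thesis by auto
  qed
  then have van: "A * ?H \<in> vanishing_ideal n S"
    using AH by (auto simp: vanishing_ideal_def form_def)
  have nz: "\<forall>x\<in>p. peval (B * ?H) x \<noteq> 0"
    using A(5) 2 by (auto simp: std_open_def)
  have eq: "\<forall>x\<in>\<Union>?U. peval (B * ?H) x \<noteq> 0 \<longrightarrow> s x = peval (A * ?H) x / peval (B * ?H) x"
    using A(6) by auto
  have deg: "int (a + (b + (1 + 1))) - int (b + (b + (1 + 1))) = q" using A(4) by simp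
  show ?case by (rule fractionI[OF van AH BH deg nz eq])
qed

lemma vanishing_ideal_section_zero:
  assumes "s \<in> sheaf_sections n (vanishing_ideal n S) q U" "p \<in> S" "p \<in> U" "x \<in> p"
  shows "s x = 0"
proof -
  obtain A a b B where A:
    "A \<in> vanishing_ideal n S" "form n a A" "form n b B" "int a - int b = q" "\<forall>x\<in>p. peval B x \<noteq> 0"
    "\<forall>x\<in>\<Union>U. peval B x \<noteq> 0 \<longrightarrow> s x = peval A x / peval B x"
    by (rule sheaf_sectionsE[OF assms(1) vanishing_ideal_subset assms(3)])
  have "peval A x = 0" using A(1) assms by (auto simp: vanishing_ideal_def)
  moreover have "x \<in> \<Union>U" using assms by auto
  ultimately show ?thesis using A(5,6) assms by auto
qed

text \<open>
  A local representation \<open>A / B\<close> on the \<open>i\<close>-th open set becomes one on the whole space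
  once \<open>A\<close> and \<open>B\<close> are multiplied by \<open>x\<^sub>i\<close>, since the new denominator is zero outside that set.
\<close>

lemma sheaf_sections_glue:
  assumes h: "\<And>i. i \<le> n \<Longrightarrow> h i \<in> sheaf_sections n (poly_ring n) q (std_open n i)"
    and agree: "\<And>i j x. i \<le> n \<Longrightarrow> j \<le> n \<Longrightarrow> x \<in> \<Union>(std_open n i \<inter> std_open n j) \<Longrightarrow> h i x = h j x"
  obtains f where "f \<in> sheaf_sections n (poly_ring n) q (proj_space n)"
    "\<And>i x. i \<le> n \<Longrightarrow> x \<in> \<Union>(std_open n i) \<Longrightarrow> f x = h i x"
proof -
  define f where "f x = (if x \<in> nonzero_vecs n then h (SOME i. i \<le> n \<and> x i \<noteq> 0) x else 0)" for x
  have f: "f x = h i x" if "i \<le> n" "x \<in> \<Union>(std_open n i)" for i x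
  proof -
    have x: "x \<in> nonzero_vecs n" "x i \<noteq> 0" using that(2) unfolding mem_Union_std_open by auto
    let ?j = "SOME i. i \<le> n \<and> x i \<noteq> 0"
    have j: "?j \<le> n \<and> x ?j \<noteq> 0" by (rule someI[of _ i]) (use that x in auto)
    have "h ?j x = h i x"
      by (rule agree) (use j x that in \<open>auto simp only: mem_Union_std_open_Int\<close>)
    then show ?thesis using x by (simp add: f_def)
  qed
  have "f \<in> sheaf_sections n (poly_ring n) q (proj_space n)"
  proof (rule sheaf_sectionsI, goal_cases)
    case (1 x)
    then show ?case by (simp only: mem_Union_proj_space f_def) simp
  next
    case (2 p)
    obtain x where x: "x \<in> p" using point_nonempty[OF 2] by blast
    then obtain i where i: "i \<le> n" "x i \<noteq> 0"
      using point_eq(2)[OF 2] by (auto simp: nonzero_vecs_def)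
    then have pi: "p \<in> std_open n i" using mem_std_open_iff[OF 2 x] by simp
    obtain A a b B where A:
      "A \<in> poly_ring n" "form n a A" "form n b B" "int a - int b = q" "\<forall>x\<in>p. peval B x \<noteq> 0"
      "\<forall>x\<in>\<Union>(std_open n i). peval B x \<noteq> 0 \<longrightarrow> h i x = peval A x / peval B x"
      by (rule sheaf_sectionsE[OF h[OF i(1)] subset_refl pi])
    note AX = form_mult[OF A(2) form_var[OF i(1)]] and BX = form_mult[OF A(3) form_var[OF i(1)]]
    have nz: "\<forall>x\<in>p. peval (B * var i) x \<noteq> 0"
      using A(5) pi by (auto simp: std_open_def)
    have eq: "\<forall>x\<in>\<Union>(proj_space n). peval (B * var i) x \<noteq> 0 \<longrightarrow>
        f x = peval (A * var i) x / peval (B * var i) x"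
    proof (intro ballI impI)
      fix x assume x: "x \<in> \<Union>(proj_space n)" "peval (B * var i) x \<noteq> 0"
      then have "x \<in> nonzero_vecs n \<and> x i \<noteq> 0" unfolding mem_Union_proj_space by simp
      then have "x \<in> \<Union>(std_open n i)" unfolding mem_Union_std_open .
      with f[OF i(1) this] A(6) x(2) show "f x = peval (A * var i) x / peval (B * var i) x" by auto
    qed
    have deg: "int (a + 1) - int (b + 1) = q" using A(4) by simp
    have "A * var i \<in> poly_ring n" using AX by (simp add: form_def)
    from fractionI[OF this AX BX deg nz eq] show ?case .
  qed
  with f show ?thesis by (rule that[rotated]) 
qed

lemma quotient_dim_0:
  assumes "quotient_dim Z B = 0" "c \<in> Z"
  shows "\<exists>k. k \<noteq> 0 \<and> (\<lambda>x. k * c x) \<in> B"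
proof (rule ccontr)
  assume neg: "\<not> ?thesis"
  let ?X = "{T. finite T \<and> T \<subseteq> Z \<and>
      (\<forall>u. (\<lambda>x. \<Sum>t\<in>T. u t * t x) \<in> B \<longrightarrow> (\<forall>t\<in>T. u t = 0))}"
  have "{c} \<in> ?X" using neg assms(2) by auto
  then have "enat (card {c}) \<le> quotient_dim Z B"
    unfolding quotient_dim_def by (rule SUP_upper)
  then show False using assms(1) by (simp add: zero_enat_def)
qed

lemma power_int_quotient: "(z::'a::field) \<noteq> 0 \<Longrightarrow> z powi e = z ^ nat e / z ^ nat (- e)"
  by (auto simp: power_int_def divide_simps)

text \<open>
  This is the surjectivity of \<open>H\<^sup>0(\<O>(q)) \<rightarrow> H\<^sup>0(\<O>\<^sub>S(q))\<close> for one value at \<open>p\<close> and zeros elsewhere. Local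
  lifts \<open>g\<^sub>i\<close> to the standard open sets agree on \<open>S\<close>, so that their differences form
  a cocycle of \<open>\<I>\<^sub>S(q)\<close>. Some nonzero multiple \<open>k (g\<^sub>j - g\<^sub>i)\<close> is a coboundary \<open>g'\<^sub>j - g'\<^sub>i\<close>, and the
  functions \<open>k g\<^sub>i - g'\<^sub>i\<close> glue to a global section with the values of \<open>k g\<^sub>i\<close> on \<open>S\<close>.
\<close>

lemma separating_section:
  fixes S :: "'a::field point set"
  assumes S: "S \<subseteq> proj_space n" "finite S" and p: "p \<in> S"
    and h1: "h1 n (vanishing_ideal n S) q = 0"
  obtains f where "f \<in> sheaf_sections n (poly_ring n) q (proj_space n)"
    "\<forall>x\<in>p. f x \<noteq> 0" "\<forall>x\<in>\<Union>(S - {p}). f x = 0"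
proof -
  have pP: "p \<in> proj_space n" using S p by auto
  obtain A m where A: "form n m A" "\<forall>x\<in>p. peval A x \<noteq> 0" "\<forall>y\<in>\<Union>(S - {p}). peval A y = 0"
    using separating_form[of "S - {p}" n p] S pP by blast
  obtain x0 where x0: "x0 \<in> p" using point_nonempty[OF pP] by blast
  \<comment> \<open>On the open sets containing \<open>p\<close>, the form \<open>A\<close> is brought to degree \<open>q\<close> by a power of \<open>y i\<close>. The
     factor \<open>x0 i\<close> normalizes this power to \<open>1\<close> at \<open>x0\<close>, so that the values on \<open>p\<close> do not depend
     on \<open>i\<close>.\<close>
  define e where "e = q - int m"
  define g where "g i y = (if p \<in> std_open n i \<and> y \<in> \<Union>(std_open n i)
      then peval A y * (y i / x0 i) powi e else 0)" for i y
  have g_sec: "g i \<in> sheaf_sections n (poly_ring n) q (std_open n i)" if i: "i \<le> n" for i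
  proof (rule sheaf_sectionsI, goal_cases)
    case (1 x)
    then show ?case by (simp add: g_def)
  next
    case (2 p')
    define k where "k = (if p \<in> std_open n i then 1 / x0 i powi e else 0)"
    let ?N = "const k * (A * var i ^ nat e)" and ?D = "var i ^ nat (- e) :: 'a mpol"
    have N: "form n (m + nat e * 1) ?N" and D: "form n (nat (- e) * 1) ?D"
      by (intro form_smult form_mult form_power form_var A i)+
    have deg: "int (m + nat e * 1) - int (nat (- e) * 1) = q" by (simp add: e_def)
    have nz: "\<forall>x\<in>p'. peval ?D x \<noteq> 0" using 2 by (auto simp: std_open_def)
    have eq: "\<forall>x\<in>\<Union>(std_open n i). peval ?D x \<noteq> 0 \<longrightarrow> g i x = peval ?N x / peval ?D x"
    proof (intro ballI impI)
      fix x :: "nat \<Rightarrow> 'a" assume x: "x \<in> \<Union>(std_open n i)"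
      then have "x i \<noteq> 0" unfolding mem_Union_std_open by simp
      with x show "g i x = peval ?N x / peval ?D x"
        by (simp add: g_def k_def power_int_divide_distrib power_int_quotient[of "x i"] del: Union_iff)
    qed
    have "?N \<in> poly_ring n" using N by (simp add: form_def)
    from fractionI[OF this N D deg nz eq] show ?case .
  qed
  have g_eq: "g i y = g j y" if y: "y \<in> \<Union>S" and yij: "y \<in> \<Union>(std_open n i \<inter> std_open n j)" for i j y
  proof -
    obtain p' where p': "p' \<in> S" "y \<in> p'" using y by auto
    have y0: "y i \<noteq> 0" "y j \<noteq> 0" using yij unfolding mem_Union_std_open_Int by auto
    show ?thesis
    proof (cases "p' = p")
      case True
      then obtain c where c: "c \<noteq> 0" "y = (\<lambda>i. c * x0 i)" using point_eq(1)[OF pP x0] p' by auto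
      with y0 have "x0 i \<noteq> 0" "x0 j \<noteq> 0" by auto
      then have "y i / x0 i = y j / x0 j" using c by simp
      moreover have "p \<in> std_open n i" "p \<in> std_open n j"
        using mem_std_open_iff[OF pP x0] \<open>x0 i \<noteq> 0\<close> \<open>x0 j \<noteq> 0\<close> by auto
      ultimately show ?thesis using yij by (auto simp: g_def)
    next
      case False
      then have "peval A y = 0" using A(3) p' by auto
      then show ?thesis by (simp add: g_def)
    qed
  qed
  define c where "c = (\<lambda>(i, j, y). if i \<le> n \<and> j \<le> n \<and> y \<in> \<Union>(std_open n i \<inter> std_open n j)
      then g j y - g i y else 0)"
  have "c \<in> cech_cocycles1 n (vanishing_ideal n S) q"
    unfolding cech_cocycles1_def mem_Collect_eq
  proof (intro conjI allI impI ballI)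
    fix i j assume ij: "i \<le> n" "j \<le> n"
    let ?U = "std_open n i \<inter> std_open n j :: 'a point set"
    have "(\<lambda>y. 1 * (if y \<in> \<Union>?U then g j y else 0) + (- 1) * (if y \<in> \<Union>?U then g i y else 0))
        \<in> sheaf_sections n (poly_ring n) q ?U"
      by (intro sheaf_sections_lincomb)
         (use sheaf_sections_restrict[OF g_sec[OF ij(2)] subset_refl, of ?U]
            sheaf_sections_restrict[OF g_sec[OF ij(1)] subset_refl, of ?U] in auto)
    also have "(\<lambda>y. 1 * (if y \<in> \<Union>?U then g j y else 0) + (- 1) * (if y \<in> \<Union>?U then g i y else 0)) =
        (\<lambda>y. c (i, j, y))"
      using ij by (auto simp: c_def fun_eq_iff)
    finally show "(\<lambda>y. c (i, j, y)) \<in> sheaf_sections n (vanishing_ideal n S) q ?U"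
      by (intro section_in_vanishing_ideal S ij) (use g_eq in \<open>auto simp: c_def\<close>)
  next
    fix i j x assume "n < i \<or> n < j" then show "c (i, j, x) = 0" by (auto simp: c_def)
  next
    fix i j k and x :: "nat \<Rightarrow> 'a" assume "i \<le> n" "j \<le> n" "k \<le> n"
      and "x \<in> \<Union>(std_open n i \<inter> std_open n j \<inter> std_open n k)"
    then have "x \<in> \<Union>(std_open n i \<inter> std_open n j)" "x \<in> \<Union>(std_open n i \<inter> std_open n k)"
      "x \<in> \<Union>(std_open n j \<inter> std_open n k)" by auto
    with \<open>i \<le> n\<close> \<open>j \<le> n\<close> \<open>k \<le> n\<close> show "c (j, k, x) - c (i, k, x) + c (i, j, x) = 0"
      by (simp add: c_def del: Union_iff)
  qed
  then obtain k where k: "k \<noteq> 0" "(\<lambda>z. k * c z) \<in> cech_coboundaries1 n (vanishing_ideal n S) q"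
    using quotient_dim_0 h1 unfolding h1_def by blast
  then obtain g' where g': "\<forall>i\<le>n. g' i \<in> sheaf_sections n (vanishing_ideal n S) q (std_open n i)"
    and kc: "(\<lambda>z. k * c z) = (\<lambda>(i, j, x). if i \<le> n \<and> j \<le> n \<and> x \<in> \<Union>(std_open n i \<inter> std_open n j)
                  then g' j x - g' i x else 0)"
    unfolding cech_coboundaries1_def by blast
  define h where "h i x = k * g i x + (- 1) * g' i x" for i x
  have "h i \<in> sheaf_sections n (poly_ring n) q (std_open n i)" if "i \<le> n" for i
    unfolding h_def
    using g_sec[OF that] g' that sheaf_sections_mono[OF vanishing_ideal_subset subset_refl]
    by (intro sheaf_sections_lincomb) blast+
  moreover have "h i x = h j x" if "i \<le> n" "j \<le> n" "x \<in> \<Union>(std_open n i \<inter> std_open n j)" for i j x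
  proof -
    have "k * (g j x - g i x) = g' j x - g' i x"
      using fun_cong[OF kc, of "(i, j, x)"] that by (simp add: c_def del: Union_iff)
    then show ?thesis by (simp add: h_def algebra_simps)
  qed
  ultimately obtain f where f: "f \<in> sheaf_sections n (poly_ring n) q (proj_space n)"
    "\<And>i x. i \<le> n \<Longrightarrow> x \<in> \<Union>(std_open n i) \<Longrightarrow> f x = h i x"
    using sheaf_sections_glue[of n h q] by blast
  have val: "\<exists>i. x i \<noteq> 0 \<and> p' \<in> std_open n i \<and> f x = k * g i x" if x: "p' \<in> S" "x \<in> p'" for p' x
  proof -
    have p': "p' \<in> proj_space n" using x S by auto
    obtain i where i: "i \<le> n" "x i \<noteq> 0" using point_eq(2)[OF p' x(2)] by (auto simp: nonzero_vecs_def)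
    then have pi: "p' \<in> std_open n i" using mem_std_open_iff[OF p' x(2)] by simp
    then have "f x = h i x" using f(2)[OF i(1)] x by blast
    moreover have "g' i x = 0"
      using vanishing_ideal_section_zero[OF _ x(1) pi x(2)] g' i by blast
    ultimately show ?thesis using i pi by (auto simp: h_def)
  qed
  show ?thesis
  proof (rule that[OF f(1)])
    show "\<forall>x\<in>p. f x \<noteq> 0"
    proof
      fix x assume x: "x \<in> p"
      then obtain i where i: "x i \<noteq> 0" "p \<in> std_open n i" "f x = k * g i x" using val[OF p x] by auto
      moreover have "x0 i \<noteq> 0" using i x0 by (auto simp: std_open_def)
      ultimately show "f x \<noteq> 0" using k(1) A(2) x by (auto simp: g_def)
    qed
    show "\<forall>x\<in>\<Union>(S - {p}). f x = 0"
    proof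
      fix x assume x: "x \<in> \<Union>(S - {p})"
      then obtain p' where "p' \<in> S" "x \<in> p'" by auto
      then obtain i where "f x = k * g i x" using val by blast
      then show "f x = 0" using A(3) x by (auto simp: g_def)
    qed
  qed
qed

section \<open>Linear independence modulo sections vanishing doubly\<close>

text \<open>
  If the \<open>G i\<close> are linearly independent modulo a set \<open>W\<close> containing the span of \<open>Z'\<close>, then adding them
  to an independent subset of \<open>Z'\<close> gives an independent subset of \<open>Z\<close>. Below,
  \<open>W\<close> is the condition of vanishing doubly, which can be read off from power series.
\<close>

lemma quotient_dim_add_le:
  fixes G :: "'i \<Rightarrow> 'x \<Rightarrow> 'a::field"
  assumes Z: "Z' \<subseteq> Z" and fin: "finite I" and G: "\<And>i. i \<in> I \<Longrightarrow> G i \<in> Z"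
    and W: "\<And>T u. finite T \<Longrightarrow> T \<subseteq> Z' \<Longrightarrow> W (\<lambda>x. \<Sum>t\<in>T. u t * t x)"
    and ind: "\<And>c i. W (\<lambda>x. \<Sum>i\<in>I. c i * G i x) \<Longrightarrow> i \<in> I \<Longrightarrow> c i = 0"
  shows "quotient_dim Z' {\<lambda>x. 0} + enat (card I) \<le> quotient_dim Z {\<lambda>x. 0}"
proof -
  define indep where "indep Z T \<longleftrightarrow> finite T \<and> T \<subseteq> Z \<and>
      (\<forall>u. (\<lambda>x. \<Sum>t\<in>T. u t * t x) \<in> {\<lambda>x. 0} \<longrightarrow> (\<forall>t\<in>T. u t = 0))"
    for Z and T :: "('x \<Rightarrow> 'a) set"
  have qd: "quotient_dim Z {\<lambda>x. 0} = (SUP T \<in> Collect (indep Z). enat (card T))"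
    for Z :: "('x \<Rightarrow> 'a) set"
    unfolding quotient_dim_def by (rule arg_cong[where f = "\<lambda>X. SUP T\<in>X. enat (card T)"]) (auto simp: indep_def)
  have inj: "inj_on G I"
  proof (rule inj_onI, rule ccontr)
    fix i j assume ij: "i \<in> I" "j \<in> I" "G i = G j" "i \<noteq> j"
    let ?c = "\<lambda>k. if k = i then 1 else if k = j then - 1 else (0 :: 'a)"
    have "(\<Sum>k\<in>I. ?c k * G k x) = 0" for x
    proof -
      have "(\<Sum>k\<in>I. ?c k * G k x) = (\<Sum>k\<in>{i, j}. ?c k * G k x)"
        by (rule sum.mono_neutral_right) (use ij fin in auto)
      then show ?thesis using ij by simp
    qed
    then have "W (\<lambda>x. \<Sum>k\<in>I. ?c k * G k x)" using W[of "{}"] by simp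
    from ind[OF this ij(1)] show False by simp
  qed
  have step: "indep Z (T \<union> G ` I) \<and> card (T \<union> G ` I) = card T + card I" if T: "indep Z' T" for T
  proof -
    have T': "finite T" "T \<subseteq> Z'" using T by (auto simp: indep_def)
    have disj: "T \<inter> G ` I = {}"
    proof (rule ccontr)
      assume "T \<inter> G ` I \<noteq> {}"
      then obtain j where j: "j \<in> I" "G j \<in> T" by auto
      let ?c = "\<lambda>k. if k = j then 1 else (0 :: 'a)"
      have "(\<Sum>k\<in>I. ?c k * G k x) = (\<Sum>t\<in>{G j}. 1 * t x)" for x
        using j fin by (simp add: if_distrib[of "\<lambda>a. a * _"] cong: if_cong)
      then have "W (\<lambda>x. \<Sum>k\<in>I. ?c k * G k x)" using W[of "{G j}" "\<lambda>_. 1"] j T' by auto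
      from ind[OF this j(1)] show False by simp
    qed
    have "\<forall>t\<in>T \<union> G ` I. u t = 0" if u: "(\<lambda>x. \<Sum>t\<in>T \<union> G ` I. u t * t x) \<in> {\<lambda>x. 0}" for u
    proof -
      have 0: "(\<Sum>t\<in>T. u t * t x) + (\<Sum>i\<in>I. u (G i) * G i x) = 0" for x
        using fun_cong[OF singletonD[OF u], of x] T'(1) fin disj
        by (simp add: sum.union_disjoint sum.reindex[OF inj])
      have "(\<Sum>i\<in>I. u (G i) * G i x) = (\<Sum>t\<in>T. - u t * t x)" for x
        using 0[of x] by (simp add: sum_negf eq_neg_iff_add_eq_0 add.commute)
      then have "W (\<lambda>x. \<Sum>i\<in>I. u (G i) * G i x)" using W[OF T', of "\<lambda>t. - u t"] by simp
      then have I0: "u (G i) = 0" if "i \<in> I" for i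
        using ind[of "\<lambda>i. u (G i)" i] that by blast
      then have "(\<Sum>t\<in>T. u t * t x) = 0" for x using 0[of x] by simp
      then have "\<forall>t\<in>T. u t = 0" using T by (auto simp: indep_def)
      with I0 show ?thesis by auto
    qed
    moreover have "T \<union> G ` I \<subseteq> Z" using T' Z G by auto
    ultimately have "indep Z (T \<union> G ` I)" using T' fin by (simp add: indep_def)
    then show ?thesis using T' fin disj inj by (simp add: card_Un_disjoint card_image)
  qed
  have le: "enat (card T) + enat (card I) \<le> quotient_dim Z {\<lambda>x. 0}" if "indep Z' T" for T
  proof -
    have "enat (card (T \<union> G ` I)) \<le> quotient_dim Z {\<lambda>x. 0}"
      unfolding qd by (rule SUP_upper) (use step[OF that] in simp)
    then show ?thesis using step[OF that] by simp
  qed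
  show ?thesis
  proof (cases "quotient_dim Z {\<lambda>x. 0}")
    case (enat m)
    have "indep Z' {}" by (simp add: indep_def)
    from le[OF this] have m: "card I \<le> m" by (simp add: enat)
    have "quotient_dim Z' {\<lambda>x. 0} \<le> enat (m - card I)"
      unfolding qd by (rule SUP_least) (use le m in \<open>force simp: enat\<close>)
    then have "quotient_dim Z' {\<lambda>x. 0} + enat (card I) \<le> enat (m - card I) + enat (card I)"
      by (rule add_right_mono)
    then show ?thesis using m by (simp add: enat)
  qed simp
qed

text \<open>
  Expand along the line from \<open>x \<in> p\<close> in direction \<open>v\<close>. The summands belonging to \<open>p' \<noteq> p\<close> contain the
  square of a series without constant term and do not contribute up to first order. What remains
  is \<open>H * (\<ell>(x) + \<ell>(v) t)\<close> with the linear form \<open>\<ell> = \<Sum>\<^sub>i c (p, i) X\<^sub>i\<close> and a series \<open>H\<close> of nonzero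
  constant term. Hence \<open>\<ell>(x) = 0\<close> and then \<open>\<ell>(v) = 0\<close>, and taking unit vectors for \<open>v\<close> shows that
  all coefficients are zero.
\<close>

lemma first_order_independence:
  fixes S :: "'a::field_char_0 point set"
  assumes S: "S \<subseteq> proj_space n" "finite S"
    and f: "\<And>p. p \<in> S \<Longrightarrow> f p \<in> sheaf_sections n (poly_ring n) q (proj_space n)"
      "\<And>p x. p \<in> S \<Longrightarrow> x \<in> p \<Longrightarrow> f p x \<noteq> 0"
      "\<And>p x. p \<in> S \<Longrightarrow> x \<in> \<Union>(S - {p}) \<Longrightarrow> f p x = 0"
    and j: "\<And>p x. p \<in> S \<Longrightarrow> x \<in> p \<Longrightarrow> x (j p) \<noteq> 0"
    and van: "vanishes_doubly n S
      (\<lambda>y. \<Sum>(p, i)\<in>S \<times> {..n}. c (p, i) * (f p y ^ 2 * y (j p) ^ k * y i))"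
    and p: "p \<in> S" and i: "i \<le> n"
  shows "c (p, i) = 0"
proof -
  obtain x where x: "x \<in> p" using point_nonempty p S by blast
  have pP: "p \<in> proj_space n" using p S by auto
  let ?L = "\<lambda>v i. fps_of_poly [:x i, v i:]"
  have key: "(\<Sum>i\<le>n. c (p, i) * x i) = 0 \<and> (\<Sum>i\<le>n. c (p, i) * v i) = 0" if v: "\<forall>i>n. v i = 0" for v
  proof -
    have "\<exists>\<phi>. expands (f p') x v \<phi>" if "p' \<in> S" for p'
      using section_expands[OF f(1)[OF that] subset_refl pP x v] by blast
    then obtain \<phi> where \<phi>: "\<And>p'. p' \<in> S \<Longrightarrow> expands (f p') x v (\<phi> p')" by metis
    let ?T = "\<lambda>p' i. fps_const (c (p', i)) * (\<phi> p' ^ 2 * ?L v (j p') ^ k * ?L v i)"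
    have e1: "expands (\<lambda>y. \<Sum>z\<in>S \<times> {..n}. (case z of (p', i) \<Rightarrow> c (p', i) * (f p' y ^ 2 * y (j p') ^ k * y i)))
        x v (\<Sum>z\<in>S \<times> {..n}. (case z of (p', i) \<Rightarrow> ?T p' i))"
    proof (rule expands_sum)
      fix z assume "z \<in> S \<times> {..n}"
      then obtain p' i where z: "z = (p', i)" "p' \<in> S" by auto
      show "expands (\<lambda>y. case z of (p', i) \<Rightarrow> c (p', i) * (f p' y ^ 2 * y (j p') ^ k * y i))
          x v (case z of (p', i) \<Rightarrow> ?T p' i)"
        unfolding z(1) prod.case
        by (intro expands_mult expands_power expands_const expands_coordinate \<phi> z(2))
    qed
    obtain \<psi> where e2: "expands (\<lambda>y. \<Sum>(p, i)\<in>S \<times> {..n}. c (p, i) * (f p y ^ 2 * y (j p) ^ k * y i)) x v \<psi>"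
      and \<psi>: "fps_nth \<psi> 0 = 0" "fps_nth \<psi> 1 = 0"
      using van x p v unfolding vanishes_doubly_def by blast
    have "\<psi> = (\<Sum>(p', i)\<in>S \<times> {..n}. ?T p' i)" by (rule expands_unique[OF e2 e1])
    also have "\<dots> = (\<Sum>p'\<in>S. \<Sum>i\<le>n. ?T p' i)" by (rule sum.cartesian_product[symmetric])
    finally have eq: "\<psi> = (\<Sum>p'\<in>S. \<Sum>i\<le>n. ?T p' i)" .
    have other: "fps_nth (\<Sum>i\<le>n. ?T p' i) l = 0" if "p' \<in> S - {p}" "l \<le> 1" for p' l
    proof -
      have "fps_nth (\<phi> p') 0 = f p' x" using expands_at_0 \<phi> that by blast
      also have "\<dots> = 0" using f(3)[of p' x] that p x by auto
      finally have 0: "fps_nth (\<phi> p') 0 = 0" .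
      then have "fps_nth (\<phi> p' ^ 2) 0 = 0" "fps_nth (\<phi> p' ^ 2) 1 = 0"
        by (simp_all add: power2_eq_square fps_mult_nth_1)
      then have "fps_nth (\<phi> p' ^ 2 * g) l = 0" for g
        using that(2) by (cases l) (auto simp: fps_mult_nth_1)
      then show ?thesis by (simp add: fps_sum_nth mult.assoc)
    qed
    define H where "H = \<phi> p ^ 2 * ?L v (j p) ^ k"
    have H: "fps_nth H 0 \<noteq> 0"
      using expands_at_0[OF \<phi>[OF p]] f(2)[OF p x] j[OF p x]
      by (simp add: H_def power2_eq_square fps_power_zeroth)
    have nth: "fps_nth (\<Sum>i\<le>n. ?T p i) l = 0" if "l \<le> 1" for l
    proof -
      have "fps_nth \<psi> l = fps_nth (\<Sum>i\<le>n. ?T p i) l + (\<Sum>p'\<in>S - {p}. fps_nth (\<Sum>i\<le>n. ?T p' i) l)"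
        unfolding eq by (simp add: fps_sum_nth sum.remove[OF S(2) p])
      also have "(\<Sum>p'\<in>S - {p}. fps_nth (\<Sum>i\<le>n. ?T p' i) l) = 0"
        by (rule sum.neutral) (use other that in blast)
      finally show ?thesis using \<psi> that by (cases l) auto
    qed
    have "(\<Sum>i\<le>n. ?T p i) = H * (\<Sum>i\<le>n. fps_const (c (p, i)) * ?L v i)"
      by (simp add: H_def sum_distrib_left mult_ac)
    with nth have nth': "fps_nth (H * (\<Sum>i\<le>n. fps_const (c (p, i)) * ?L v i)) l = 0" if "l \<le> 1" for l
      using that by simp
    have 0: "(\<Sum>i\<le>n. c (p, i) * x i) = 0"
      using nth'[of 0] H by (simp add: fps_sum_nth)
    then have "(\<Sum>i\<le>n. c (p, i) * v i) = 0"
      using nth'[of 1] H by (simp add: fps_sum_nth fps_mult_nth_1)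
    with 0 show ?thesis by simp
  qed
  have "(\<Sum>l\<le>n. c (p, l) * (if l = i then 1 else 0)) = 0" using key[of "\<lambda>l. if l = i then 1 else 0"] i by auto
  then show ?thesis using i by (simp add: if_distrib cong: if_cong)
qed

theorem proposition4p7:
  fixes S :: "'a::{alg_closed_field, field_char_0} point set"
    and n r d :: nat
  assumes "S \<subseteq> proj_space n" and "finite S" and "card S = r"
    and "d > 0"
    and "\<exists>q::int. real_of_int q < real d / 2 \<and> h1 n (vanishing_ideal n S) q = 0"
  shows "S \<notin> terracini_locus n d r"
proof -
  obtain q :: int where q: "real_of_int q < real d / 2" "h1 n (vanishing_ideal n S) q = 0"
    using assms(5) by blast
  define k where "k = nat (int d - 2 * q - 1)"
  have "real_of_int (2 * q) < real_of_int (int d)" using q(1) by simp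
  then have "2 * q < int d" by (simp only: of_int_less_iff)
  then have k: "q + q + int (k + 1) = int d" by (simp add: k_def)
  let ?O = "sheaf_sections n (poly_ring n :: 'a mpol set)"
  have "\<forall>p\<in>S. \<exists>f. f \<in> ?O q (proj_space n) \<and> (\<forall>x\<in>p. f x \<noteq> 0) \<and> (\<forall>x\<in>\<Union>(S - {p}). f x = 0)"
    using separating_section[OF assms(1,2) _ q(2)] by metis
  from bchoice[OF this] obtain f where "\<forall>p\<in>S. f p \<in> ?O q (proj_space n) \<and>
      (\<forall>x\<in>p. f p x \<noteq> 0) \<and> (\<forall>x\<in>\<Union>(S - {p}). f p x = 0)" ..
  then have f: "\<And>p. p \<in> S \<Longrightarrow> f p \<in> ?O q (proj_space n)"
    "\<And>p x. p \<in> S \<Longrightarrow> x \<in> p \<Longrightarrow> f p x \<noteq> 0"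
    "\<And>p x. p \<in> S \<Longrightarrow> x \<in> \<Union>(S - {p}) \<Longrightarrow> f p x = 0"
    by blast+
  have "\<exists>j\<le>n. p \<in> std_open n j" if "p \<in> S" for p
  proof -
    have p: "p \<in> proj_space n" using that assms(1) by auto
    obtain x where x: "x \<in> p" using point_nonempty[OF p] by blast
    then obtain j where "j \<le> n" "x j \<noteq> 0" using point_eq(2)[OF p] by (auto simp: nonzero_vecs_def)
    then show ?thesis using mem_std_open_iff[OF p x] by auto
  qed
  then obtain j where j: "\<And>p. p \<in> S \<Longrightarrow> j p \<le> n" "\<And>p. p \<in> S \<Longrightarrow> p \<in> std_open n (j p)" by metis
  define G where "G = (\<lambda>(p, i) y. f p y ^ 2 * y (j p) ^ k * y i)"
  have G_sec: "G z \<in> ?O (int d) (proj_space n)" if "z \<in> S \<times> {..n}" for z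
  proof -
    from that obtain p i where z: "z = (p, i)" "p \<in> S" "i \<le> n" by auto
    let ?M = "var (j p) ^ k * var i :: 'a mpol"
    have "form n (k * 1 + 1) ?M" by (intro form_mult form_power form_var j z)
    from sheaf_sections_mult[OF sheaf_sections_mult[OF f(1) f(1)] sheaf_sections_form[OF this], OF z(2) z(2)]
    have "(\<lambda>y. f p y * f p y * (if y \<in> \<Union>(proj_space n) then peval ?M y else 0)) \<in> ?O (int d) (proj_space n)"
      using k by simp
    also have "(\<lambda>y. f p y * f p y * (if y \<in> \<Union>(proj_space n) then peval ?M y else 0)) = G z"
      using sheaf_sections_outside[OF f(1)[OF z(2)]] by (auto simp: G_def z power2_eq_square fun_eq_iff)
    finally show ?thesis .
  qed
  have "h0 n (double_points_ideal n S) (int d) + enat (card (S \<times> {..n})) \<le> h0 n (poly_ring n :: 'a mpol set) (int d)"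
    unfolding h0_def
  proof (rule quotient_dim_add_le[where G = G and W = "vanishes_doubly n S"])
    show "sheaf_sections n (double_points_ideal n S) (int d) (proj_space n) \<subseteq> ?O (int d) (proj_space n)"
      by (rule sheaf_sections_mono[OF double_points_ideal_subset subset_refl])
    show "finite (S \<times> {..n})" using assms(2) by simp
    show "\<And>z. z \<in> S \<times> {..n} \<Longrightarrow> G z \<in> ?O (int d) (proj_space n)" by (rule G_sec)
  next
    fix T u assume "finite T" "T \<subseteq> sheaf_sections n (double_points_ideal n S) (int d) (proj_space n)"
    then show "vanishes_doubly n S (\<lambda>x. \<Sum>t\<in>T. u t * t x)"
      using double_section_vanishes_doubly[OF assms(1)] by (intro vanishes_doubly_sum) blast
  next
    fix c z assume van: "vanishes_doubly n S (\<lambda>x. \<Sum>z\<in>S \<times> {..n}. c z * G z x)" and z: "z \<in> S \<times> {..n}"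
    have "vanishes_doubly n S (\<lambda>y. \<Sum>(p, i)\<in>S \<times> {..n}. c (p, i) * (f p y ^ 2 * y (j p) ^ k * y i))"
      using van by (simp add: G_def case_prod_beta)
    moreover have "x (j p) \<noteq> 0" if "p \<in> S" "x \<in> p" for p x
      using j(2) that by (auto simp: std_open_def)
    moreover obtain p i where "z = (p, i)" "p \<in> S" "i \<le> n" using z by auto
    ultimately show "c z = 0"
      using first_order_independence[OF assms(1,2) f, where j = j and c = c and k = k] by simp
  qed
  moreover have "card (S \<times> {..n}) = (n + 1) * r" using assms(3) by (simp add: card_cartesian_product)
  ultimately show ?thesis by (simp add: terracini_locus_def not_less)
qed

end
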